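(* Let $A_n$ denote the number of ways to tile an $n$-board using squares and $(1,1)$-fences. Then for all integers $n\ge 0$, \[ A_{2n}=f_n^2,\qquad A_{2n+1}=f_nf_{n+1}, \] where $f_n=F_{n+1}$ and $F_m$ is the $m$th Fibonacci number.
   Context: An $n$-board is a $1\times n$ row of $n$ unit cells. A square is a $1\times1$ tile covering one cell. A $(1,1)$-fence is a tile made of two $1\times1$ subtiles (posts) separated by a gap of width one cell; when placed on a board its posts occupy cells $i$ and $i+2$ for some $i$, and the gap cell $i+1$ is not covered by the fence (it must be covered by some other tile, e.g. a square or a post of another fence). A tiling of an $n$-board is a placement of tiles covering every cell exactly once. The empty $0$-board has exactly one tiling, so $A_0=1$. Fibonacci numbers: $F_0=0$, $F_1=1$, $F_m=F_{m-1}+F_{m-2}$ for $m\ge2$. *)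

theory Defs
  imports "HOL-Number_Theory.Fib"
begin

text \<open>
  A tile is represented together with its position on the board, given by its leftmost cell;
  the cells of an n-board are numbered from 0 to n - 1.  The gap of a fence is not among its cells.
\<close>

datatype tile = Square nat | Fence nat

fun cells :: "tile \<Rightarrow> nat set" where
  "cells (Square i) = {i}"
| "cells (Fence i) = {i, i + 2}"

definition is_tiling :: "nat \<Rightarrow> tile set \<Rightarrow> bool" where
  "is_tiling n T \<longleftrightarrow>
     (\<forall>t\<in>T. cells t \<subseteq> {..<n}) \<and> (\<forall>c<n. \<exists>!t. t \<in> T \<and> c \<in> cells t)"

definition A :: "nat \<Rightarrow> nat" where
  "A n = card {T. is_tiling n T}"

definition f :: "nat \<Rightarrow> nat" where
  "f n = fib (n + 1)"

lemma finite_tilings: "finite {T. is_tiling n T}"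
proof (rule finite_subset)
  show "{T. is_tiling n T} \<subseteq> Pow (Square ` {..<n} \<union> Fence ` {..<n})"
  proof (intro subsetI PowI)
    fix T t assume "T \<in> {T. is_tiling n T}" "t \<in> T"
    then have "cells t \<subseteq> {..<n}" by (auto simp: is_tiling_def)
    then show "t \<in> Square ` {..<n} \<union> Fence ` {..<n}" by (cases t) auto
  qed
qed simp

lemma A_0: "A 0 = 1"
proof -
  have "cells t \<noteq> {}" for t by (cases t) auto
  then have "{T. is_tiling 0 T} = {{}}" by (auto simp: is_tiling_def)
  then show ?thesis by (simp add: A_def)
qed

end

theory Submission
  imports Defs
begin

text \<open>
  Fences join cells of equal parity, so a tiling splits into independent tilings of the even and of
  the odd cells, in which a fence has become a domino.  A board of \<open>m\<close> cells has \<open>f m\<close> tilings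
  by squares and dominoes, and the two boards have \<open>(n + 1) div 2\<close> and \<open>n div 2\<close> cells.
\<close>

text \<open>
  The possible sets of left ends of disjoint tiles \<open>{i, i + d}\<close> on an \<open>n\<close>-board: such a set
  determines a tiling, the remaining cells being covered by squares.
\<close>
definition left_ends :: "nat \<Rightarrow> nat \<Rightarrow> nat set set" where
  "left_ends d n = {S. \<forall>i\<in>S. i + d < n \<and> i + d \<notin> S}"

lemma finite_left_ends: "finite (left_ends d n)"
  by (rule finite_subset[of _ "Pow {..<n}"]) (auto simp: left_ends_def)

lemma mem_cells_iff:
  "c \<in> cells t \<longleftrightarrow> t = Square c \<or> t = Fence c \<or> (\<exists>i. t = Fence i \<and> c = i + 2)"
  by (cases t) auto

lemma is_tiling_unique:
  assumes "is_tiling n T" "t \<in> T" "u \<in> T" "c \<in> cells t" "c \<in> cells u"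
  shows "t = u"
proof -
  have "c < n" using assms by (auto simp: is_tiling_def)
  then have "\<exists>!t. t \<in> T \<and> c \<in> cells t" using assms by (auto simp: is_tiling_def)
  then show ?thesis using assms by blast
qed

text \<open>Two distinct fences share a cell only if their left ends differ by 2, so
  \<open>i + 2 \<notin> S\<close> says exactly that the fences are disjoint.\<close>

lemma bij_betw_tilings_left_ends:
  "bij_betw (\<lambda>T. {i. Fence i \<in> T}) {T. is_tiling n T} (left_ends 2 n)"
proof -
  define tiling where
    "tiling S = Fence ` S \<union> Square ` {c. c < n \<and> c \<notin> S \<and> (\<forall>i\<in>S. c \<noteq> i + 2)}" for S
  have "tiling {i. Fence i \<in> T} = T" if T: "is_tiling n T" for T
  proof -
    have "Square c \<in> T \<longleftrightarrow> c < n \<and> Fence c \<notin> T \<and> (\<forall>i. Fence i \<in> T \<longrightarrow> c \<noteq> i + 2)" for c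
    proof (intro iffI conjI allI impI notI)
      assume c: "Square c \<in> T"
      then show "c < n" using T by (force simp: is_tiling_def)
      show False if "Fence c \<in> T"
        using is_tiling_unique[OF T c that, of c] by simp
      show False if "Fence i \<in> T" "c = i + 2" for i
        using is_tiling_unique[OF T c that(1), of c] that(2) by simp
    next
      assume c: "c < n \<and> Fence c \<notin> T \<and> (\<forall>i. Fence i \<in> T \<longrightarrow> c \<noteq> i + 2)"
      then obtain t where "t \<in> T" "c \<in> cells t" using T by (auto simp: is_tiling_def)
      then show "Square c \<in> T" using c by (auto simp: mem_cells_iff)
    qed
    then have "t \<in> tiling {i. Fence i \<in> T} \<longleftrightarrow> t \<in> T" for t
      by (cases t) (auto simp: tiling_def)
    then show ?thesis by blast
  qed
  moreover have "{i. Fence i \<in> T} \<in> left_ends 2 n" if T: "is_tiling n T" for T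
  proof -
    have "i + 2 < n" if "Fence i \<in> T" for i
      using T that by (force simp: is_tiling_def)
    moreover have "Fence (i + 2) \<notin> T" if "Fence i \<in> T" for i
      using is_tiling_unique[OF T that, of "Fence (i + 2)" "i + 2"] by auto
    ultimately show ?thesis by (simp add: left_ends_def)
  qed
  moreover have "is_tiling n (tiling S)" if S: "S \<in> left_ends 2 n" for S
    unfolding is_tiling_def
  proof (intro conjI ballI allI impI)
    show "cells t \<subseteq> {..<n}" if "t \<in> tiling S" for t
      using that S by (fastforce simp: tiling_def left_ends_def)
    fix c assume "c < n"
    \<comment> \<open>The cell is a left post, a right post, or under no fence;
      \<open>S \<in> left_ends 2 n\<close> makes the first two cases exclusive.\<close>
    then consider "c \<in> S" | i where "i \<in> S" "c = i + 2" | "c \<notin> S" "\<forall>i\<in>S. c \<noteq> i + 2"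
      by blast
    then show "\<exists>!t. t \<in> tiling S \<and> c \<in> cells t"
    proof cases
      case 1
      then show ?thesis using S
        by (intro ex1I[of _ "Fence c"]) (auto simp: tiling_def left_ends_def mem_cells_iff)
    next
      case 2
      then show ?thesis using S
        by (intro ex1I[of _ "Fence i"]) (auto simp: tiling_def left_ends_def mem_cells_iff)
    next
      case 3
      then show ?thesis using \<open>c < n\<close>
        by (intro ex1I[of _ "Square c"]) (auto simp: tiling_def mem_cells_iff)
    qed
  qed
  moreover have "{i. Fence i \<in> tiling S} = S" for S
    by (auto simp: tiling_def)
  ultimately show ?thesis
    by (intro bij_betw_byWitness[where f' = tiling]) auto
qed

text \<open>A shift by 2 keeps parity and becomes a shift by 1 after halving. The bounds match:
  \<open>2 * i + 2 < n\<close> iff \<open>i + 1 < (n + 1) div 2\<close>, and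
  \<open>2 * i + 3 < n\<close> iff \<open>i + 1 < n div 2\<close>.\<close>

lemma bij_betw_left_ends_parity:
  "bij_betw (\<lambda>S. ({i. 2 * i \<in> S}, {i. 2 * i + 1 \<in> S}))
     (left_ends 2 n) (left_ends 1 ((n + 1) div 2) \<times> left_ends 1 (n div 2))"
proof -
  define join :: "nat set \<times> nat set \<Rightarrow> nat set" where
    "join = (\<lambda>(U, V). (\<lambda>i. 2 * i) ` U \<union> (\<lambda>i. 2 * i + 1) ` V)"
  have even_join: "2 * i \<in> join (U, V) \<longleftrightarrow> i \<in> U" for i U V
    by (auto simp: join_def) presburger
  have odd_join: "2 * i + 1 \<in> join (U, V) \<longleftrightarrow> i \<in> V" for i U V
    by (auto simp: join_def) presburger
  have "j \<in> join ({i. 2 * i \<in> S}, {i. 2 * i + 1 \<in> S}) \<longleftrightarrow> j \<in> S" for j S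
    by (cases "even j") (auto elim!: evenE oddE simp: even_join odd_join[simplified])
  then have "join ({i. 2 * i \<in> S}, {i. 2 * i + 1 \<in> S}) = S" for S
    by blast
  moreover have "{i. 2 * i \<in> S} \<in> left_ends 1 ((n + 1) div 2)"
    and "{i. 2 * i + 1 \<in> S} \<in> left_ends 1 (n div 2)" if "S \<in> left_ends 2 n" for S
    using that by (fastforce simp: left_ends_def)+
  moreover have "join (U, V) \<in> left_ends 2 n"
    if "U \<in> left_ends 1 ((n + 1) div 2)" "V \<in> left_ends 1 (n div 2)" for U V
  proof -
    have "i + 2 < n \<and> i + 2 \<notin> join (U, V)" if "i \<in> join (U, V)" for i
    proof (cases "even i")
      case True
      then obtain k where "i = 2 * k" by blast
      \<comment> \<open>Here \<open>i + 2 = 2 * (k + 1)\<close>, hence the second instance at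
        \<open>k + 1\<close>.\<close>
      then show ?thesis
        using that \<open>U \<in> _\<close> even_join[of k U V] even_join[of "k + 1" U V]
        by (auto simp: left_ends_def)
    next
      case False
      then obtain k where "i = 2 * k + 1" by (blast elim: oddE)
      then show ?thesis
        using that \<open>V \<in> _\<close> odd_join[of k U V] odd_join[of "k + 1" U V]
        by (auto simp: left_ends_def)
    qed
    then show ?thesis by (simp add: left_ends_def)
  qed
  ultimately show ?thesis
    by (intro bij_betw_byWitness[where f' = join]) (auto simp: even_join odd_join[simplified])
qed

text \<open>Case split on the last cell \<open>m + 1\<close>: either a square covers it, or a domino
  starting at \<open>m\<close> does, which leaves a board of \<open>m\<close> cells.\<close>

lemma left_ends_1_Suc_Suc:
  "left_ends 1 (Suc (Suc m)) = left_ends 1 (Suc m) \<union> insert m ` left_ends 1 m"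
proof (intro equalityI subsetI)
  fix S assume S: "S \<in> left_ends 1 (Suc (Suc m))"
  show "S \<in> left_ends 1 (Suc m) \<union> insert m ` left_ends 1 m"
  proof (cases "m \<in> S")
    case True
    \<comment> \<open>The value \<open>i + 1 = m\<close> is excluded because \<open>m\<close> is
      itself a left end.\<close>
    have "i + 1 < m" if "i \<in> S - {m}" for i
      using S that True by (cases "i + 1 = m") (auto simp: left_ends_def less_Suc_eq)
    then have "S - {m} \<in> left_ends 1 m" using S by (auto simp: left_ends_def)
    then show ?thesis using True by (metis UnI2 imageI insert_Diff)
  next
    case False
    then show ?thesis using S by (auto simp: left_ends_def less_Suc_eq)
  qed
qed (auto simp: left_ends_def)

text \<open>The preceding split is the Fibonacci recurrence; boards of 0 and 1 cells admit no
  domino, matching \<open>f 0 = f 1 = 1\<close>.\<close>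

lemma card_left_ends_1: "card (left_ends 1 m) = f m"
proof (induction m rule: fib.induct)
  case 1
  have "left_ends 1 0 = {{}}" by (auto simp: left_ends_def)
  then show ?case by (simp add: f_def)
next
  case 2
  have "left_ends 1 (Suc 0) = {{}}" by (auto simp: left_ends_def)
  then show ?case by (simp add: f_def)
next
  case (3 m)
  have notin: "m \<notin> S" if "S \<in> left_ends 1 m" for S
    using that by (auto simp: left_ends_def)
  have "inj_on (insert m) (left_ends 1 m)"
    using notin by (meson inj_onI insert_ident)
  then have "card (insert m ` left_ends 1 m) = f m"
    using 3 by (simp add: card_image)
  \<comment> \<open>A left end on \<open>m + 1\<close> cells is less than \<open>m\<close>.\<close>
  moreover have "left_ends 1 (Suc m) \<inter> insert m ` left_ends 1 m = {}"
    by (auto simp: left_ends_def)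
  ultimately show ?case
    unfolding left_ends_1_Suc_Suc using 3
    by (simp add: card_Un_disjoint finite_left_ends f_def)
qed

text \<open>One formula serves both parities of \<open>n\<close>: the two half boards have equal
  length for even \<open>n\<close> and differ by one cell for odd \<open>n\<close>.\<close>

lemma A_eq: "A n = f ((n + 1) div 2) * f (n div 2)"
proof -
  have "A n = card (left_ends 2 n)"
    unfolding A_def using bij_betw_tilings_left_ends by (rule bij_betw_same_card)
  also have "\<dots> = card (left_ends 1 ((n + 1) div 2) \<times> left_ends 1 (n div 2))"
    using bij_betw_left_ends_parity by (rule bij_betw_same_card)
  finally show ?thesis by (simp only: card_cartesian_product card_left_ends_1)
qed

theorem theorem2p3:
  fixes n :: nat
  shows "A (2 * n) = (f n)\<^sup>2 \<and> A (2 * n + 1) = f n * f (n + 1)"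
  by (simp add: A_eq power2_eq_square)

end
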